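(* Let $\mu,\nu>0$ and let $X_1,\ldots,X_n$ be i.i.d. $\mathrm{NB}(\nu,\frac{\nu}{\nu+\mu})$ (mean $\mu$, variance $\sigma^2=\frac{\nu+\mu}{\nu}\mu$). Let $f:\mathbb{N}_0\to\mathbb{R}$ be such that all moments $\tilde\mu_{klm}$ below are finite and $\eta_1:=\tilde\mu_{110}-\mu\tilde\mu_{001}\neq0$. Consider $$\hat\nu_{f,\mathrm{NB}}=\frac{\overline{X}\ \overline{X\Delta f(X)}}{\overline{Xf(X)}-\overline{X}\ \overline{f(X+1)}}.$$ Then $\hat\nu_{f,\mathrm{NB}}$ is asymptotically normally distributed with asymptotic variance $$\begin{aligned}\sigma^2_{f,\mathrm{NB}}=\frac{1}{\eta_1^4n}\Big[&\mu^4\Big(\tilde\mu_{001}\big(\tilde\mu_{001}(\tilde\mu_{202}-2\tilde\mu_{211}+\tilde\mu_{220})-2(\tilde\mu_{101}-\tilde\mu_{110})(\tilde\mu_{102}-\tilde\mu_{111})\big)+\tilde\mu_{002}(\tilde\mu_{101}-\tilde\mu_{110})^2\Big)\\ &+2\mu^3\Big(\tilde\mu_{001}\tilde\mu_{101}(\tilde\mu_{211}-\tilde\mu_{220})-\tilde\mu_{110}\big(\tilde\mu_{001}(\tilde\mu_{202}-\tilde\mu_{211})+\tilde\mu_{102}\tilde\mu_{110}\big)-\tilde\mu_{101}^2\tilde\mu_{111}+\tilde\mu_{101}\tilde\mu_{110}(\tilde\mu_{102}+\tilde\mu_{111})\Big)\\ &+\mu^2\Big(\tilde\mu_{110}\Big(2\tilde\mu_{101}\big(-\tilde\mu_{001}\tilde\mu_{201}+\tilde\mu_{001}\tilde\mu_{210}+\tilde\mu_{110}^2-\tilde\mu_{211}\big)+\tilde\mu_{110}\big(2\tilde\mu_{001}\tilde\mu_{201}-2\tilde\mu_{001}\tilde\mu_{210}+\tilde\mu_{202}\big)\\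 &\qquad+2\tilde\mu_{101}^3-4\tilde\mu_{101}^2\tilde\mu_{110}\Big)+\tilde\mu_{101}^2\tilde\mu_{220}\Big)\\ &-2\mu\,\tilde\mu_{110}(\tilde\mu_{101}-\tilde\mu_{110})(\tilde\mu_{101}\tilde\mu_{210}-\tilde\mu_{110}\tilde\mu_{201})+\tilde\mu_{110}^2\sigma^2(\tilde\mu_{101}-\tilde\mu_{110})^2\Big]\end{aligned}$$ and asymptotic bias $$\begin{aligned}\mathbb{B}_{f,\mathrm{NB}}=-\frac{1}{\eta_1^3n}\Big[&\mu^3\big(\tilde\mu_{001}(\tilde\mu_{102}-\tilde\mu_{111})+\tilde\mu_{002}(\tilde\mu_{110}-\tilde\mu_{101})\big)\\ &-\mu^2\big(\tilde\mu_{001}(\tilde\mu_{211}-\tilde\mu_{220})-2\tilde\mu_{101}\tilde\mu_{111}+\tilde\mu_{110}(\tilde\mu_{102}+\tilde\mu_{111})\big)\\ &+\mu\Big(\tilde\mu_{101}\big(\tilde\mu_{001}\tilde\mu_{210}+2\tilde\mu_{110}^2-\tilde\mu_{220}\big)+\tilde\mu_{110}\big(\tilde\mu_{001}\tilde\mu_{201}-2\tilde\mu_{001}\tilde\mu_{210}+\tilde\mu_{211}\big)-2\tilde\mu_{101}^2\tilde\mu_{110}\Big)\\ &+\tilde\mu_{110}\big(\tilde\mu_{001}\sigma^2(\tilde\mu_{110}-\tilde\mu_{101})+\tilde\mu_{101}\tilde\mu_{210}-\tilde\mu_{110}\tilde\mu_{201}\big)\Big].\end{aligned}$$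
   Context: $\mathrm{NB}(\nu,\pi)$ has pmf $P(X=x)=\binom{\nu+x-1}{x}(1-\pi)^x\pi^\nu$, $x\in\mathbb{N}_0$. $\Delta f(x)=f(x+1)-f(x)$; $\overline{h(X)}=\frac1n\sum_ih(X_i)$. For $X$ with the stated NB law, $\tilde\mu_{klm}:=\tilde\mu_f(k,l,m):=\mathbb{E}[X^kf(X)^lf(X+1)^m]$. Asymptotic variance and bias are in the delta-method sense: with $\mathbf Z_i=(X_i,f(X_i+1),X_if(X_i),X_if(X_i+1))^\top$, $\overline{\mathbf Z}=\frac1n\sum_i\mathbf Z_i$, $g_\nu(x_1,x_2,x_3,x_4)=x_1(x_4-x_3)/(x_3-x_1x_2)$ (so $\hat\nu_{f,\mathrm{NB}}=g_\nu(\overline{\mathbf Z})$ and $\nu=g_\nu(\boldsymbol\mu_Z)$, $\boldsymbol\mu_Z=\mathbb{E}[\mathbf Z_1]$), $\boldsymbol\Sigma=\mathrm{Cov}(\mathbf Z_1)$, and $\mathbf D,\mathbf H$ the gradient and Hessian of $g_\nu$ at $\boldsymbol\mu_Z$, the statement means $\sqrt n(\hat\nu_{f,\mathrm{NB}}-\nu)\xrightarrow{d}N(0,n\sigma^2_{f,\mathrm{NB}})$ with $\sigma^2_{f,\mathrm{NB}}=\frac1n\mathbf D^\top\boldsymbol\Sigma\mathbf D$, and $\mathbb B_{f,\mathrm{NB}}=\frac1{2n}\sum_{i,j}H_{ij}\Sigma_{ij}$. *)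

theory Defs
  imports "HOL-Probability.Probability"
begin

definition nb_pmf :: "real \<Rightarrow> real \<Rightarrow> nat \<Rightarrow> real" where
  "nb_pmf \<nu> p x = ((\<nu> + real x - 1) gchoose x) * (1 - p) ^ x * p powr \<nu>"

text \<open>Law NB(nu, nu/(nu+mu)) (mean mu).\<close>
definition nb_mu :: "real \<Rightarrow> real \<Rightarrow> nat \<Rightarrow> real" where
  "nb_mu \<nu> \<mu> = nb_pmf \<nu> (\<nu> / (\<nu> + \<mu>))"

definition nb_E :: "real \<Rightarrow> real \<Rightarrow> (nat \<Rightarrow> real) \<Rightarrow> real" where
  "nb_E \<nu> \<mu> h = (\<Sum>x. nb_mu \<nu> \<mu> x * h x)"

definition mom_fun :: "(nat \<Rightarrow> real) \<Rightarrow> nat \<Rightarrow> nat \<Rightarrow> nat \<Rightarrow> nat \<Rightarrow> real" where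
  "mom_fun f k l m x = real x ^ k * f x ^ l * f (Suc x) ^ m"

definition mt :: "(nat \<Rightarrow> real) \<Rightarrow> real \<Rightarrow> real \<Rightarrow> nat \<Rightarrow> nat \<Rightarrow> nat \<Rightarrow> real" where
  "mt f \<nu> \<mu> k l m = nb_E \<nu> \<mu> (mom_fun f k l m)"

definition mt_finite :: "(nat \<Rightarrow> real) \<Rightarrow> real \<Rightarrow> real \<Rightarrow> nat \<Rightarrow> nat \<Rightarrow> nat \<Rightarrow> bool" where
  "mt_finite f \<nu> \<mu> k l m \<longleftrightarrow> summable (\<lambda>x. \<bar>nb_mu \<nu> \<mu> x * mom_fun f k l m x\<bar>)"

definition Zc :: "(nat \<Rightarrow> real) \<Rightarrow> nat \<Rightarrow> nat \<Rightarrow> real" where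
  "Zc f j x = (if j = 0 then real x else if j = 1 then f (Suc x)
               else if j = 2 then real x * f x else real x * f (Suc x))"

definition muZ :: "(nat \<Rightarrow> real) \<Rightarrow> real \<Rightarrow> real \<Rightarrow> nat \<Rightarrow> real" where
  "muZ f \<nu> \<mu> j = nb_E \<nu> \<mu> (Zc f j)"

definition SigmaZ :: "(nat \<Rightarrow> real) \<Rightarrow> real \<Rightarrow> real \<Rightarrow> nat \<Rightarrow> nat \<Rightarrow> real" where
  "SigmaZ f \<nu> \<mu> i j = nb_E \<nu> \<mu> (\<lambda>x. Zc f i x * Zc f j x) - muZ f \<nu> \<mu> i * muZ f \<nu> \<mu> j"

definition g_nu :: "(nat \<Rightarrow> real) \<Rightarrow> real" where
  "g_nu v = v 0 * (v 3 - v 2) / (v 2 - v 0 * v 1)"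

definition unitv :: "nat \<Rightarrow> nat \<Rightarrow> real" where
  "unitv i = (\<lambda>j. if j = i then 1 else 0)"

definition grad_g :: "(nat \<Rightarrow> real) \<Rightarrow> nat \<Rightarrow> real" where
  "grad_g v i = deriv (\<lambda>t. g_nu (\<lambda>k. v k + t * unitv i k)) 0"

definition hess_g :: "(nat \<Rightarrow> real) \<Rightarrow> nat \<Rightarrow> nat \<Rightarrow> real" where
  "hess_g v i j = deriv (\<lambda>s. deriv (\<lambda>t. g_nu (\<lambda>k. v k + s * unitv i k + t * unitv j k)) 0) 0"

definition quad_DSD :: "(nat \<Rightarrow> real) \<Rightarrow> real \<Rightarrow> real \<Rightarrow> real" where
  "quad_DSD f \<nu> \<mu> = (\<Sum>i<4. \<Sum>j<4. grad_g (muZ f \<nu> \<mu>) i * SigmaZ f \<nu> \<mu> i j * grad_g (muZ f \<nu> \<mu>) j)"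

definition asym_var :: "(nat \<Rightarrow> real) \<Rightarrow> real \<Rightarrow> real \<Rightarrow> nat \<Rightarrow> real" where
  "asym_var f \<nu> \<mu> n = quad_DSD f \<nu> \<mu> / real n"

definition asym_bias :: "(nat \<Rightarrow> real) \<Rightarrow> real \<Rightarrow> real \<Rightarrow> nat \<Rightarrow> real" where
  "asym_bias f \<nu> \<mu> n = (\<Sum>i<4. \<Sum>j<4. hess_g (muZ f \<nu> \<mu>) i j * SigmaZ f \<nu> \<mu> i j) / (2 * real n)"

definition normal_law :: "real \<Rightarrow> real measure" where
  "normal_law v = (if v = 0 then return borel 0 else density lborel (normal_density 0 (sqrt v)))"

definition smean :: "(nat \<Rightarrow> 'a \<Rightarrow> nat) \<Rightarrow> nat \<Rightarrow> (nat \<Rightarrow> real) \<Rightarrow> 'a \<Rightarrow> real" where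
  "smean X n h \<omega> = (\<Sum>i<n. h (X i \<omega>)) / real n"

definition nu_hat :: "(nat \<Rightarrow> real) \<Rightarrow> (nat \<Rightarrow> 'a \<Rightarrow> nat) \<Rightarrow> nat \<Rightarrow> 'a \<Rightarrow> real" where
  "nu_hat f X n \<omega> =
     smean X n real \<omega> * smean X n (\<lambda>x. real x * (f (Suc x) - f x)) \<omega> /
     (smean X n (\<lambda>x. real x * f x) \<omega> - smean X n real \<omega> * smean X n (\<lambda>x. f (Suc x)) \<omega>)"

end

theory Submission
  imports Defs "HOL-Real_Asymp.Real_Asymp"
begin

text \<open>
  By Stein's identity \<open>E[X h(X)] = \<mu>/(\<nu>+\<mu>) E[(\<nu>+X) h(X+1)]\<close> for the negative binomial law, applied to
  \<open>h = 1\<close>, \<open>h(x) = x\<close> and \<open>h = f\<close>, the mean vector of \<open>Z\<close> is mapped to \<open>\<nu>\<close> by \<open>g\<^sub>\<nu>\<close> and \<open>Var X = \<sigma>\<^sup>2\<close>.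
  As \<open>\<eta>\<^sub>1 \<noteq> 0\<close>, \<open>g\<^sub>\<nu>\<close> agrees with its linearisation at the mean up to a quadratic error, which is
  negligible after scaling by \<open>sqrt n\<close>; the linear part is a sample mean, to which the central limit
  theorem applies (its variance may be zero, in which case it vanishes almost surely).
  Perturbations that tend to zero in probability are absorbed by Levy's continuity theorem.
  The closed formulas are polynomial identities, once derivatives are brought to the
  common denominators \<open>\<eta>\<^sub>1\<^sup>2\<close> and \<open>\<eta>\<^sub>1\<^sup>3\<close>.
\<close>

subsection \<open>The delta method\<close>

text \<open>Slutsky's argument through characteristic functions:
  \<open>x \<mapsto> iexp (t * x)\<close> has modulus 1 and is
  \<open>\<bar>t\<bar>\<close>-Lipschitz. Off the event \<open>e < \<bar>U n - Y n\<bar>\<close> the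
  integrands therefore differ by at most \<open>\<bar>t\<bar> * e\<close>, on it by at most 2. Levy
  continuity turns the resulting convergence back into weak convergence.\<close>

lemma weak_conv_m_if_tendsto_in_prob:
  fixes M :: "'a measure" and U Y :: "nat \<Rightarrow> 'a \<Rightarrow> real"
  assumes "prob_space M"
    and U [measurable]: "\<And>n. U n \<in> borel_measurable M"
    and Y [measurable]: "\<And>n. Y n \<in> borel_measurable M"
    and N: "real_distribution N"
    and conv: "weak_conv_m (\<lambda>n. distr M borel (Y n)) N"
    and diff: "\<And>e. e > 0 \<Longrightarrow> (\<lambda>n. measure M {\<omega> \<in> space M. e < \<bar>U n \<omega> - Y n \<omega>\<bar>}) \<longlonglongrightarrow> 0"
  shows "weak_conv_m (\<lambda>n. distr M borel (U n)) N"
proof -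
  interpret prob_space M by fact
  have dU: "real_distribution (distr M borel (U n))" and dY: "real_distribution (distr M borel (Y n))" for n
    by (simp_all add: real_distribution_distr)
  have char_distr: "char (distr M borel V) t = (CLINT \<omega>|M. iexp (t * V \<omega>))"
    if [measurable]: "V \<in> borel_measurable M" for V t
    by (simp add: char_def integral_distr)
  have int_iexp: "complex_integrable M (\<lambda>\<omega>. iexp (t * V \<omega>))"
    if [measurable]: "V \<in> borel_measurable M" for V :: "'a \<Rightarrow> real" and t
    by (intro integrable_const_bound[where B=1]) (auto simp: norm_exp_i_times)
  show ?thesis
  proof (rule levy_continuity[OF dU N])
    fix t
    have bound: "cmod (char (distr M borel (U n)) t - char (distr M borel (Y n)) t)
        \<le> \<bar>t\<bar> * e + 2 * measure M {\<omega> \<in> space M. e < \<bar>U n \<omega> - Y n \<omega>\<bar>}" if e: "e > 0" for n e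
    proof -
      let ?A = "{\<omega> \<in> space M. e < \<bar>U n \<omega> - Y n \<omega>\<bar>}"
      have pt: "cmod (iexp (t * U n \<omega>) - iexp (t * Y n \<omega>)) \<le> \<bar>t\<bar> * e + 2 * indicator ?A \<omega>"
        if \<omega>: "\<omega> \<in> space M" for \<omega>
      proof (cases "\<omega> \<in> ?A")
        case True
        have "cmod (iexp (t * U n \<omega>) - iexp (t * Y n \<omega>)) \<le> cmod (iexp (t * U n \<omega>)) + cmod (iexp (t * Y n \<omega>))"
          by (rule norm_triangle_ineq4)
        also have "\<dots> = 2" by (simp add: norm_exp_i_times)
        finally show ?thesis using True e by (simp add: add_increasing)
      next
        case False
        have "iexp (t * U n \<omega>) - iexp (t * Y n \<omega>)
            = iexp (t * Y n \<omega>) * (iexp (t * (U n \<omega> - Y n \<omega>)) - 1)"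
          by (simp add: algebra_simps flip: exp_add)
        then have "cmod (iexp (t * U n \<omega>) - iexp (t * Y n \<omega>)) = cmod (iexp (t * (U n \<omega> - Y n \<omega>)) - 1)"
          by (simp add: norm_mult norm_exp_i_times)
        also have "\<dots> \<le> \<bar>t * (U n \<omega> - Y n \<omega>)\<bar>"
          using iexp_approx1[of "t * (U n \<omega> - Y n \<omega>)" 0] by simp
        also have "\<dots> \<le> \<bar>t\<bar> * e"
          using False \<omega> by (auto simp: abs_mult intro!: mult_left_mono)
        finally show ?thesis using False by simp
      qed
      have int: "integrable M (\<lambda>\<omega>. \<bar>t\<bar> * e + 2 * indicator ?A \<omega>)"
        by (intro Bochner_Integration.integrable_add integrable_mult_right) (auto simp: emeasure_eq_measure)
      have "cmod (char (distr M borel (U n)) t - char (distr M borel (Y n)) t)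
          = cmod (CLINT \<omega>|M. iexp (t * U n \<omega>) - iexp (t * Y n \<omega>))"
        using int_iexp[OF U, of t n] int_iexp[OF Y, of t n] by (simp add: char_distr)
      also have "\<dots> \<le> (\<integral>\<omega>. cmod (iexp (t * U n \<omega>) - iexp (t * Y n \<omega>)) \<partial>M)"
        by (rule integral_norm_bound)
      also have "\<dots> \<le> (\<integral>\<omega>. \<bar>t\<bar> * e + 2 * indicator ?A \<omega> \<partial>M)"
        using int_iexp[OF U, of t n] int_iexp[OF Y, of t n] int pt
        by (intro integral_mono) auto
      also have "\<dots> = \<bar>t\<bar> * e + 2 * measure M ?A"
        by (subst Bochner_Integration.integral_add) (auto simp: emeasure_eq_measure prob_space)
      finally show ?thesis .
    qed
    have "(\<lambda>n. char (distr M borel (U n)) t - char (distr M borel (Y n)) t) \<longlonglongrightarrow> 0"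
    proof (rule LIMSEQ_I, simp)
      fix r :: real assume r: "r > 0"
      \<comment> \<open>This makes \<open>\<bar>t\<bar> * e\<close> less than \<open>r / 2\<close>;
        the summand 1 keeps the denominator positive when \<open>t = 0\<close>. The probability
        term, which enters with factor 2, is then pushed below \<open>r / 4\<close>.\<close>
      define e where "e = r / (2 * (\<bar>t\<bar> + 1))"
      have e: "e > 0" using r by (simp add: e_def add_nonneg_pos)
      have te: "\<bar>t\<bar> * e < r / 2"
        using r by (simp add: e_def field_simps add_nonneg_pos)
      obtain n0 where n0: "\<And>n. n \<ge> n0 \<Longrightarrow> \<bar>measure M {\<omega> \<in> space M. e < \<bar>U n \<omega> - Y n \<omega>\<bar>}\<bar> < r / 4"
        using LIMSEQ_D[OF diff[OF e], of "r / 4"] r by auto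
      show "\<exists>no. \<forall>n\<ge>no. cmod (char (distr M borel (U n)) t - char (distr M borel (Y n)) t) < r"
      proof (intro exI allI impI)
        fix n assume "n0 \<le> n"
        then show "cmod (char (distr M borel (U n)) t - char (distr M borel (Y n)) t) < r"
          using n0[of n] te bound[OF e, of n] by linarith
      qed
    qed
    from tendsto_add[OF this levy_continuity1[OF dY N conv, of t]]
    show "(\<lambda>n. char (distr M borel (U n)) t) \<longlonglongrightarrow> char N t" by simp
  qed
qed

section \<open>Centred normal laws, including the degenerate one\<close>

lemma real_distribution_normal_law: "v \<ge> 0 \<Longrightarrow> real_distribution (normal_law v)"
  by (auto simp: normal_law_def real_distribution_def real_distribution_axioms_def
      intro!: prob_space_return prob_space_normal_density)

text \<open>A nondegenerate centred normal law is a scaled standard normal, so its characteristic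
  function at \<open>t\<close> is the standard one at \<open>t * sqrt v\<close>.\<close>

lemma normal_law_eq_distr:
  assumes "v > 0"
  shows "normal_law v = distr std_normal_distribution borel (\<lambda>x. sqrt v * x)"
proof -
  interpret S: prob_space std_normal_distribution by (rule prob_space_normal_density) simp
  have "distributed std_normal_distribution lborel (\<lambda>x. x) std_normal_density"
    by (auto simp: distributed_def distr_id2)
  from S.normal_density_affine[OF this, of "sqrt v" 0] assms
  have "distributed std_normal_distribution lborel (\<lambda>x. sqrt v * x) (normal_density 0 (sqrt v))" by simp
  then have "distr std_normal_distribution lborel (\<lambda>x. sqrt v * x) = density lborel (normal_density 0 (sqrt v))"
    by (simp add: distributed_def)
  moreover have "distr std_normal_distribution lborel (\<lambda>x. sqrt v * x) = distr std_normal_distribution borel (\<lambda>x. sqrt v * x)"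
    by (intro distr_cong) auto
  ultimately show ?thesis using assms by (simp add: normal_law_def)
qed

section \<open>Sums of independent centred variables\<close>

context prob_space
begin

text \<open>A new summand is independent of the partial sum and centred, so the cross term in the
  expanded square has expectation 0. Integrability and value are proved in one induction because the
  value at each step relies on the integrability of the previous square.\<close>

lemma indep_sum_second_moment:
  fixes W :: "nat \<Rightarrow> 'a \<Rightarrow> real"
  assumes ind: "indep_vars (\<lambda>_. borel) W UNIV"
    and sq: "\<And>i. integrable M (\<lambda>\<omega>. (W i \<omega>)\<^sup>2)"
    and mean: "\<And>i. expectation (W i) = 0"
    and var: "\<And>i. expectation (\<lambda>\<omega>. (W i \<omega>)\<^sup>2) = v"
  shows "integrable M (\<lambda>\<omega>. (\<Sum>i<n. W i \<omega>)\<^sup>2)" (is "?I n")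
    and "expectation (\<lambda>\<omega>. (\<Sum>i<n. W i \<omega>)\<^sup>2) = real n * v" (is "?E n")
proof -
  have W[measurable]: "W i \<in> borel_measurable M" for i
    using ind unfolding indep_vars_def2 by auto
  have Wint: "integrable M (W i)" for i
    by (rule square_integrable_imp_integrable[OF _ sq]) simp
  have "?I n \<and> ?E n"
  proof (induction n)
    case 0
    then show ?case by simp
  next
    case (Suc n)
    have iv: "indep_var borel (W n) borel (\<lambda>\<omega>. \<Sum>i<n. W i \<omega>)"
      using indep_vars_sum[of "{..<n}" n W] indep_vars_subset[OF ind] by auto
    have Sint: "integrable M (\<lambda>\<omega>. \<Sum>i<n. W i \<omega>)" using Wint by auto
    have cross: "integrable M (\<lambda>\<omega>. W n \<omega> * (\<Sum>i<n. W i \<omega>))"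
       and cross0: "expectation (\<lambda>\<omega>. W n \<omega> * (\<Sum>i<n. W i \<omega>)) = 0"
      using indep_var_integrable[OF iv Wint Sint] indep_var_lebesgue_integral[OF iv Wint Sint]
      by (auto simp: mean)
    have eq: "(\<Sum>i<Suc n. W i \<omega>)\<^sup>2 = ((\<Sum>i<n. W i \<omega>)\<^sup>2 + 2 * (W n \<omega> * (\<Sum>i<n. W i \<omega>))) + (W n \<omega>)\<^sup>2" for \<omega>
      by (simp add: power2_eq_square algebra_simps)
    show ?case
      unfolding eq using Suc cross cross0 sq[of n] var[of n] by (simp add: algebra_simps)
  qed
  then show "?I n" "?E n" by auto
qed

text \<open>For \<open>v > 0\<close> the standardised central limit theorem is rescaled by
  \<open>sqrt v\<close> at the level of characteristic functions. For \<open>v = 0\<close> all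
  summands vanish almost surely and every law in the sequence is already the point mass at
  0.\<close>

lemma central_limit_theorem_normal_law:
  fixes W :: "nat \<Rightarrow> 'a \<Rightarrow> real"
  assumes ind: "indep_vars (\<lambda>_. borel) W UNIV"
    and sq: "\<And>i. integrable M (\<lambda>\<omega>. (W i \<omega>)\<^sup>2)"
    and mean: "\<And>i. expectation (W i) = 0"
    and var: "\<And>i. expectation (\<lambda>\<omega>. (W i \<omega>)\<^sup>2) = v"
    and ident: "\<And>i. distr M borel (W i) = L"
  shows "weak_conv_m (\<lambda>n. distr M borel (\<lambda>\<omega>. sqrt (real n) * ((\<Sum>i<n. W i \<omega>) / real n))) (normal_law v)"
proof -
  have W[measurable]: "W i \<in> borel_measurable M" for i
    using ind unfolding indep_vars_def2 by auto
  have v0: "v \<ge> 0" unfolding var[of 0, symmetric] by simp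
  let ?Y = "\<lambda>n \<omega>. sqrt (real n) * ((\<Sum>i<n. W i \<omega>) / real n)"
  have dY: "real_distribution (distr M borel (?Y n))" for n
    by (simp add: real_distribution_distr)
  show ?thesis
  proof (cases "v = 0")
    case True
    have "AE \<omega> in M. ?Y n \<omega> = 0" for n
    proof -
      \<comment> \<open>A nonnegative function with integral 0 vanishes almost everywhere; countably
        many exceptional null sets are then united.\<close>
      have "AE \<omega> in M. (W i \<omega>)\<^sup>2 = 0" for i
        using integral_nonneg_eq_0_iff_AE[OF sq[of i]] var[of i] True by auto
      then have "AE \<omega> in M. \<forall>i. W i \<omega> = 0" by (subst AE_all_countable) auto
      then show ?thesis by eventually_elim simp
    qed
    then have "distr M borel (?Y n) = distr M borel (\<lambda>_. 0)" for n
      by (intro distr_cong_AE) auto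
    also have "distr M borel (\<lambda>_. 0) = return borel (0::real)"
      by (simp add: distr_const)
    finally show ?thesis
      using True by (simp add: normal_law_def weak_conv_m_def weak_conv_def)
  next
    case False
    then have v: "v > 0" using v0 by simp
    let ?T = "\<lambda>n \<omega>. (\<Sum>i<n. W i \<omega>) / sqrt (real n * (sqrt v)\<^sup>2)"
    have clt: "weak_conv_m (\<lambda>n. distr M borel (?T n)) std_normal_distribution"
      using v by (intro central_limit_theorem_zero_mean[OF ind mean _ sq _ ident]) (auto simp: mean var)
    have dT: "real_distribution (distr M borel (?T n))" for n
      by (simp add: real_distribution_distr)
    \<comment> \<open>At \<open>n = 0\<close> both sides are 0 because the sums are empty; otherwise
      this is \<open>n / sqrt n = sqrt n\<close>.\<close>
    have YT: "?Y n \<omega> = sqrt v * ?T n \<omega>" for n \<omega>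
      using v real_div_sqrt[of "real n"]
      by (cases "n = 0") (auto simp: real_sqrt_mult field_simps)
    have chs: "char (distr N borel (\<lambda>\<omega>. sqrt v * V \<omega>)) t = char (distr N borel V) (t * sqrt v)"
      if [measurable]: "V \<in> borel_measurable N" for N :: "'c measure" and V t
      by (simp add: char_def integral_distr mult.assoc)
    show ?thesis
    proof (rule levy_continuity[OF dY real_distribution_normal_law[OF v0]])
      fix t
      have "(\<lambda>n. char (distr M borel (?T n)) (t * sqrt v)) \<longlonglongrightarrow> char std_normal_distribution (t * sqrt v)"
        by (intro levy_continuity1[OF dT _ clt]) (rule real_dist_normal_dist)
      moreover have "char (distr M borel (?Y n)) t = char (distr M borel (?T n)) (t * sqrt v)" for n
        unfolding YT by (rule chs) simp
      moreover have "char (normal_law v) t = char std_normal_distribution (t * sqrt v)"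
        unfolding normal_law_eq_distr[OF v] by (subst chs) (auto simp: distr_id2)
      ultimately show "(\<lambda>n. char (distr M borel (?Y n)) t) \<longlonglongrightarrow> char (normal_law v) t" by simp
    qed
  qed
qed

text \<open>The error of linearisation is at most \<open>K * sqrt n\<close> times the squared deviation of the sample
  means, whose expectation is of order \<open>1 / n\<close>.\<close>
lemma delta_method:
  fixes X :: "nat \<Rightarrow> 'a \<Rightarrow> 'b" and h :: "'j \<Rightarrow> 'b \<Rightarrow> real" and g :: "('j \<Rightarrow> real) \<Rightarrow> real"
    and m D :: "'j \<Rightarrow> real"
  defines "Zbar \<equiv> \<lambda>n \<omega> j. (\<Sum>i<n. h j (X i \<omega>)) / real n"
  assumes ind: "indep_vars (\<lambda>_. N) X UNIV"
    and ident: "\<And>i. distr M N (X i) = P"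
    and h[measurable]: "\<And>j. j \<in> J \<Longrightarrow> h j \<in> borel_measurable N"
    and sq: "\<And>j. j \<in> J \<Longrightarrow> integrable P (\<lambda>x. (h j x)\<^sup>2)"
    and m: "\<And>j. j \<in> J \<Longrightarrow> m j = (\<integral>x. h j x \<partial>P)"
    and J: "finite J"
    and meas[measurable]: "\<And>n. (\<lambda>\<omega>. g (Zbar n \<omega>)) \<in> borel_measurable M"
    and \<delta>: "\<delta> > 0" and K: "K > 0"
    and taylor: "\<And>z. (\<Sum>j\<in>J. (z j - m j)\<^sup>2) < \<delta> \<Longrightarrow>
          \<bar>g z - g m - (\<Sum>j\<in>J. D j * (z j - m j))\<bar> \<le> K * (\<Sum>j\<in>J. (z j - m j)\<^sup>2)"
  shows "weak_conv_m (\<lambda>n. distr M borel (\<lambda>\<omega>. sqrt (real n) * (g (Zbar n \<omega>) - g m)))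
     (normal_law (\<Sum>i\<in>J. \<Sum>j\<in>J. D i * ((\<integral>x. h i x * h j x \<partial>P) - m i * m j) * D j))"
proof -
  have X[measurable]: "X i \<in> measurable M N" for i
    using ind unfolding indep_vars_def2 by auto
  have setsP[measurable_cong]: "sets P = sets N" unfolding ident[of 0, symmetric] by simp
  interpret P: prob_space P
    unfolding ident[of 0, symmetric] by (rule prob_space_distr) simp
  have intP: "integrable M (\<lambda>\<omega>. k (X i \<omega>)) \<longleftrightarrow> integrable P k"
    and EP: "expectation (\<lambda>\<omega>. k (X i \<omega>)) = (\<integral>x. k x \<partial>P)"
    if [measurable]: "k \<in> borel_measurable N" for k :: "'b \<Rightarrow> real" and i
    unfolding ident[of i, symmetric] by (simp_all add: integrable_distr_eq integral_distr)
  have hint: "integrable P (h j)" if "j \<in> J" for j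
    using that by (intro P.square_integrable_imp_integrable[OF _ sq]) auto
  \<comment> \<open>Squares dominate mixed products, since
    \<open>2 * \<bar>a * b\<bar> \<le> a\<^sup>2 + b\<^sup>2\<close>.\<close>
  have prod_int: "integrable P (\<lambda>x. h i x * h j x)" if [measurable, simp]: "i \<in> J" "j \<in> J" for i j
  proof (rule Bochner_Integration.integrable_bound[OF Bochner_Integration.integrable_add[OF sq[of i] sq[of j]]])
    show "AE x in P. norm (h i x * h j x) \<le> norm ((h i x)\<^sup>2 + (h j x)\<^sup>2)"
    proof (rule AE_I2)
      fix x
      have "2 * (\<bar>h i x\<bar> * \<bar>h j x\<bar>) \<le> (h i x)\<^sup>2 + (h j x)\<^sup>2"
        using sum_squares_bound[of "\<bar>h i x\<bar>" "\<bar>h j x\<bar>"] by (simp add: mult.assoc)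
      moreover have "0 \<le> \<bar>h i x\<bar> * \<bar>h j x\<bar>" by simp
      ultimately show "norm (h i x * h j x) \<le> norm ((h i x)\<^sup>2 + (h j x)\<^sup>2)"
        unfolding real_norm_def abs_mult by linarith
    qed
  qed auto
  \<comment> \<open>\<open>c j\<close> is the centred coordinate and \<open>w\<close> the linear
    form with coefficients \<open>D\<close> in these coordinates. The second moment of
    \<open>w\<close> is the quadratic form in the covariances that appears as the limiting
    variance.\<close>
  define c where "c j x = h j x - m j" for j x
  define w where "w x = (\<Sum>j\<in>J. D j * c j x)" for x
  have c[measurable]: "c j \<in> borel_measurable N" if [measurable]: "j \<in> J" for j
    unfolding c_def using that by measurable
  have w[measurable]: "w \<in> borel_measurable N" unfolding w_def by measurable
  have cc: "integrable P (\<lambda>x. c i x * c j x)"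
      "(\<integral>x. c i x * c j x \<partial>P) = (\<integral>x. h i x * h j x \<partial>P) - m i * m j" if "i \<in> J" "j \<in> J" for i j
  proof -
    have eq: "c i x * c j x = h i x * h j x - m i * h j x - m j * h i x + m i * m j" for x
      by (simp add: c_def algebra_simps)
    show "integrable P (\<lambda>x. c i x * c j x)"
      unfolding eq using that prod_int hint by auto
    show "(\<integral>x. c i x * c j x \<partial>P) = (\<integral>x. h i x * h j x \<partial>P) - m i * m j"
      unfolding eq using that prod_int hint by (simp add: m[symmetric] P.prob_space)
  qed
  have c_mean: "integrable P (c j)" "(\<integral>x. c j x \<partial>P) = 0" if "j \<in> J" for j
    unfolding c_def using that hint m by (auto simp: P.prob_space)
  let ?v = "\<Sum>i\<in>J. \<Sum>j\<in>J. D i * ((\<integral>x. h i x * h j x \<partial>P) - m i * m j) * D j"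
  have w_mean: "(\<integral>x. w x \<partial>P) = 0"
    unfolding w_def using c_mean by (subst Bochner_Integration.integral_sum) auto
  have w2: "(w x)\<^sup>2 = (\<Sum>i\<in>J. \<Sum>j\<in>J. D i * (c i x * c j x) * D j)" for x
    unfolding w_def power2_eq_square sum_product by (intro sum.cong) (auto simp: algebra_simps)
  have w_sq: "integrable P (\<lambda>x. (w x)\<^sup>2)"
    unfolding w2 using cc by (intro Bochner_Integration.integrable_sum) auto
  have w_var: "(\<integral>x. (w x)\<^sup>2 \<partial>P) = ?v"
    unfolding w2 using cc by (simp add: Bochner_Integration.integral_sum)
  \<comment> \<open>\<open>Q n\<close> is the squared Euclidean deviation of the sample means from
    \<open>m\<close>, and \<open>V\<close> is the trace of the covariance matrix, so that
    \<open>Q n\<close> has expectation \<open>V / n\<close>. At \<open>n = 0\<close> both are 0 by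
    the convention on division.\<close>
  define dev where "dev n j \<omega> = (\<Sum>i<n. c j (X i \<omega>)) / real n" for n j \<omega>
  define Q where "Q n \<omega> = (\<Sum>j\<in>J. (dev n j \<omega>)\<^sup>2)" for n \<omega>
  define V where "V = (\<Sum>j\<in>J. (\<integral>x. (c j x)\<^sup>2 \<partial>P))"
  have dev_sq: "integrable M (\<lambda>\<omega>. (dev n j \<omega>)\<^sup>2)"
      "expectation (\<lambda>\<omega>. (dev n j \<omega>)\<^sup>2) = (\<integral>x. (c j x)\<^sup>2 \<partial>P) / real n" if j: "j \<in> J" for n j
  proof -
    have m': "(\<lambda>x. (c j x)\<^sup>2) \<in> borel_measurable N" using j by measurable
    have "indep_vars (\<lambda>_. borel) (\<lambda>i \<omega>. c j (X i \<omega>)) UNIV"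
      by (rule indep_vars_compose2[OF ind]) (use j in auto)
    note S = indep_sum_second_moment[OF this, of "\<integral>x. (c j x)\<^sup>2 \<partial>P" n]
    have "integrable M (\<lambda>\<omega>. (\<Sum>i<n. c j (X i \<omega>))\<^sup>2)"
      "expectation (\<lambda>\<omega>. (\<Sum>i<n. c j (X i \<omega>))\<^sup>2) = real n * (\<integral>x. (c j x)\<^sup>2 \<partial>P)"
      using j cc(1)[OF j j, folded power2_eq_square] c_mean(2)[OF j]
      by (auto intro!: S simp: intP[OF m'] EP[OF m'] EP[OF c])
    then show "integrable M (\<lambda>\<omega>. (dev n j \<omega>)\<^sup>2)"
      "expectation (\<lambda>\<omega>. (dev n j \<omega>)\<^sup>2) = (\<integral>x. (c j x)\<^sup>2 \<partial>P) / real n"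
      unfolding dev_def power_divide by (auto simp: power2_eq_square)
  qed
  have Q0: "Q n \<omega> \<ge> 0" for n \<omega> unfolding Q_def by (intro sum_nonneg) auto
  have Q_int: "integrable M (Q n)" and Q_mean: "expectation (Q n) = V / real n" for n
    unfolding Q_def V_def using dev_sq
    by (auto simp: sum_divide_distrib)
  have Q[measurable]: "Q n \<in> borel_measurable M" for n using Q_int by auto
  let ?U = "\<lambda>n \<omega>. sqrt (real n) * (g (Zbar n \<omega>) - g m)"
  let ?Y = "\<lambda>n \<omega>. sqrt (real n) * ((\<Sum>i<n. w (X i \<omega>)) / real n)"
  \<comment> \<open>On the event \<open>Q n \<omega> < \<delta>\<close> the quadratic error bound
    applies to the sample means. Positivity of \<open>n\<close> is what allows \<open>m j\<close> to
    be moved into the average.\<close>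
  have lin: "\<bar>?U n \<omega> - ?Y n \<omega>\<bar> \<le> sqrt (real n) * K * Q n \<omega>" if n: "n > 0" and small: "Q n \<omega> < \<delta>" for n \<omega>
  proof -
    have d: "Zbar n \<omega> j - m j = dev n j \<omega>" for j
      using n by (simp add: Zbar_def dev_def c_def sum_subtractf diff_divide_distrib)
    have l: "(\<Sum>j\<in>J. D j * dev n j \<omega>) = (\<Sum>i<n. w (X i \<omega>)) / real n"
      unfolding dev_def w_def sum_divide_distrib sum_distrib_left
      by (subst sum.swap) simp
    have "?U n \<omega> - ?Y n \<omega> = sqrt (real n) * (g (Zbar n \<omega>) - g m - (\<Sum>j\<in>J. D j * dev n j \<omega>))"
      unfolding l by (simp add: algebra_simps)
    moreover have "\<bar>g (Zbar n \<omega>) - g m - (\<Sum>j\<in>J. D j * dev n j \<omega>)\<bar> \<le> K * Q n \<omega>"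
      using taylor[of "Zbar n \<omega>"] small unfolding d Q_def by blast
    ultimately show ?thesis by (simp add: abs_mult mult.assoc mult_left_mono)
  qed
  show ?thesis
  proof (rule weak_conv_m_if_tendsto_in_prob[where Y = ?Y])
    have "indep_vars (\<lambda>_. borel) (\<lambda>i \<omega>. w (X i \<omega>)) UNIV"
      by (rule indep_vars_compose2[OF ind]) auto
    moreover have "distr M borel (\<lambda>\<omega>. w (X i \<omega>)) = distr P borel w" for i
      unfolding ident[of i, symmetric] by (subst distr_distr) (auto simp: comp_def)
    moreover have w2m: "(\<lambda>x. (w x)\<^sup>2) \<in> borel_measurable N" by measurable
    ultimately show "weak_conv_m (\<lambda>n. distr M borel (?Y n)) (normal_law ?v)"
      by (intro central_limit_theorem_normal_law)
        (simp_all only: intP[OF w2m] EP[OF w2m] EP[OF w] w_sq w_mean w_var)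
    show "real_distribution (normal_law ?v)"
      unfolding w_var[symmetric] by (rule real_distribution_normal_law) simp
    fix e :: real assume e: "e > 0"
    \<comment> \<open>A discrepancy above \<open>e\<close> forces either \<open>Q n\<close> to leave
      the region where the linearisation is controlled, or the scaled quadratic error to reach
      \<open>e\<close>. Markov's inequality bounds the first probability by order
      \<open>1 / n\<close> and the second, after the factor \<open>sqrt n\<close>, by order
      \<open>1 / sqrt n\<close>.\<close>
    have bnd: "measure M {\<omega> \<in> space M. e < \<bar>?U n \<omega> - ?Y n \<omega>\<bar>}
        \<le> V / \<delta> / real n + (K * V / e) / sqrt (real n)" if n: "n > 0" for n
    proof -
      have "{\<omega> \<in> space M. e < \<bar>?U n \<omega> - ?Y n \<omega>\<bar>}
          \<subseteq> {\<omega> \<in> space M. Q n \<omega> \<ge> \<delta>} \<union> {\<omega> \<in> space M. sqrt (real n) * K * Q n \<omega> \<ge> e}"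
      proof (intro subsetI)
        fix \<omega> assume \<omega>: "\<omega> \<in> {\<omega> \<in> space M. e < \<bar>?U n \<omega> - ?Y n \<omega>\<bar>}"
        then have "\<delta> \<le> Q n \<omega> \<or> e \<le> sqrt (real n) * K * Q n \<omega>"
          using lin[OF n, of \<omega>] unfolding mem_Collect_eq by linarith
        then show "\<omega> \<in> {\<omega> \<in> space M. Q n \<omega> \<ge> \<delta>} \<union> {\<omega> \<in> space M. sqrt (real n) * K * Q n \<omega> \<ge> e}"
          using \<omega> by blast
      qed
      then have "measure M {\<omega> \<in> space M. e < \<bar>?U n \<omega> - ?Y n \<omega>\<bar>}
          \<le> measure M ({\<omega> \<in> space M. Q n \<omega> \<ge> \<delta>} \<union> {\<omega> \<in> space M. sqrt (real n) * K * Q n \<omega> \<ge> e})"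
        by (intro finite_measure_mono) auto
      also have "\<dots> \<le> measure M {\<omega> \<in> space M. Q n \<omega> \<ge> \<delta>} + measure M {\<omega> \<in> space M. sqrt (real n) * K * Q n \<omega> \<ge> e}"
        by (intro measure_Un_le) auto
      also have "measure M {\<omega> \<in> space M. Q n \<omega> \<ge> \<delta>} \<le> expectation (Q n) / \<delta>"
        using Q_int Q0 \<delta> by (intro integral_Markov_inequality_measure[where A="{}"]) auto
      also have "measure M {\<omega> \<in> space M. sqrt (real n) * K * Q n \<omega> \<ge> e}
          \<le> expectation (\<lambda>\<omega>. sqrt (real n) * K * Q n \<omega>) / e"
        using Q_int Q0 K e by (intro integral_Markov_inequality_measure[where A="{}"]) auto
      also have "\<dots> = (K * V / e) / sqrt (real n)"
        using sqrt_divide_self_eq[of "real n"] by (simp add: Q_mean divide_inverse mult_ac)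
      finally show ?thesis by (simp add: Q_mean mult.commute)
    qed
    have lim: "(\<lambda>n. V / \<delta> / real n + (K * V / e) / sqrt (real n)) \<longlonglongrightarrow> 0"
      by real_asymp
    have le: "\<forall>\<^sub>F n in sequentially. measure M {\<omega> \<in> space M. e < \<bar>?U n \<omega> - ?Y n \<omega>\<bar>}
        \<le> V / \<delta> / real n + (K * V / e) / sqrt (real n)"
      using eventually_gt_at_top[of 0] by eventually_elim (rule bnd)
    show "(\<lambda>n. measure M {\<omega> \<in> space M. e < \<bar>?U n \<omega> - ?Y n \<omega>\<bar>}) \<longlonglongrightarrow> 0"
      by (rule tendsto_sandwich[OF _ le tendsto_const lim]) (rule always_eventually, rule allI, rule measure_nonneg)
  qed (auto intro: prob_space_axioms)
qed

end

subsection \<open>Derivatives of the estimator\<close>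

text \<open>Numerators of the partial derivatives of \<open>g_nu\<close> over the common denominator
  \<open>(v 2 - v 0 * v 1)\<^sup>2\<close>, after cancellation.\<close>

definition grad_num :: "(nat \<Rightarrow> real) \<Rightarrow> nat \<Rightarrow> real" where
  "grad_num v j = (if j = 0 then v 2 * (v 3 - v 2) else if j = 1 then (v 0)\<^sup>2 * (v 3 - v 2)
     else if j = 2 then v 0 * (v 0 * v 1 - v 3) else v 0 * (v 2 - v 0 * v 1))"

text \<open>The directional derivative of \<open>grad_num\<close> at \<open>v\<close> along
  \<open>w\<close>; with \<open>w\<close> a unit vector it supplies the Hessian.\<close>

definition grad_num_deriv :: "(nat \<Rightarrow> real) \<Rightarrow> (nat \<Rightarrow> real) \<Rightarrow> nat \<Rightarrow> real" where
  "grad_num_deriv v w j =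
    (if j = 0 then w 2 * (v 3 - v 2) + v 2 * (w 3 - w 2)
     else if j = 1 then 2 * v 0 * w 0 * (v 3 - v 2) + (v 0)\<^sup>2 * (w 3 - w 2)
     else if j = 2 then w 0 * (v 0 * v 1 - v 3) + v 0 * (w 0 * v 1 + v 0 * w 1 - w 3)
     else w 0 * (v 2 - v 0 * v 1) + v 0 * (w 2 - w 0 * v 1 - v 0 * w 1))"

lemma less_4_cases: "(j::nat) < 4 \<Longrightarrow> j = 0 \<or> j = 1 \<or> j = 2 \<or> j = 3" by auto

text \<open>The quotient rule is applied once along a general direction \<open>w\<close>; the four
  coordinates are separated only afterwards, in a polynomial identity.\<close>

lemma grad_g_eq:
  assumes q: "v 2 - v 0 * v 1 \<noteq> 0" and j: "j < 4"
  shows "grad_g v j = grad_num v j / (v 2 - v 0 * v 1)\<^sup>2"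
proof -
  define w where "w = unitv j"
  have "((\<lambda>t. g_nu (\<lambda>k. v k + t * w k)) has_field_derivative
     ((w 0 * (v 3 - v 2) + v 0 * (w 3 - w 2)) * (v 2 - v 0 * v 1)
       - v 0 * (v 3 - v 2) * (w 2 - w 0 * v 1 - v 0 * w 1)) / (v 2 - v 0 * v 1)\<^sup>2) (at 0)"
    unfolding g_nu_def
    by (rule derivative_eq_intros refl | use q in \<open>simp; fail\<close>)+
       (use q in \<open>simp add: power2_eq_square algebra_simps\<close>)
  then have "grad_g v j = ((w 0 * (v 3 - v 2) + v 0 * (w 3 - w 2)) * (v 2 - v 0 * v 1)
       - v 0 * (v 3 - v 2) * (w 2 - w 0 * v 1 - v 0 * w 1)) / (v 2 - v 0 * v 1)\<^sup>2"
    unfolding grad_g_def w_def by (rule DERIV_imp_deriv)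
  also have "\<dots> = grad_num v j / (v 2 - v 0 * v 1)\<^sup>2"
    using less_4_cases[OF j]
    by (elim disjE) (simp_all add: grad_num_def w_def unitv_def power2_eq_square algebra_simps)
  finally show ?thesis .
qed

text \<open>One factor of \<open>q\<close> cancels in the quotient rule, which gives the cube seen
  in the bias formula instead of a fourth power.\<close>

lemma DERIV_divide_square:
  fixes P q :: "real \<Rightarrow> real"
  assumes "(P has_field_derivative P') (at x)" "(q has_field_derivative q') (at x)" "q x \<noteq> 0"
  shows "((\<lambda>s. P s / (q s)\<^sup>2) has_field_derivative (P' * q x - 2 * P x * q') / q x ^ 3) (at x)"
  by (rule derivative_eq_intros assms refl | use assms in \<open>simp; fail\<close>)+
     (use assms in \<open>simp add: field_simps power2_eq_square power3_eq_cube\<close>)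

text \<open>The inner derivative in \<open>hess_g\<close> is \<open>grad_g\<close> evaluated along
  the line through \<open>v\<close> in direction \<open>unitv i\<close>, so the quotient from
  \<open>grad_g_eq\<close> is differentiated once more.\<close>

lemma hess_g_eq:
  assumes q: "v 2 - v 0 * v 1 \<noteq> 0" and j: "j < 4"
  shows "hess_g v i j = (grad_num_deriv v (unitv i) j * (v 2 - v 0 * v 1)
      - 2 * grad_num v j * (unitv i 2 - unitv i 0 * v 1 - v 0 * unitv i 1)) / (v 2 - v 0 * v 1) ^ 3"
proof -
  define w where "w = unitv i"
  let ?p = "\<lambda>s k. v k + s * w k"
  let ?q = "\<lambda>s. ?p s 2 - ?p s 0 * ?p s 1"
  have "isCont ?q 0" by (intro continuous_intros)
  then have "?q \<midarrow>0\<rightarrow> v 2 - v 0 * v 1" by (simp add: isCont_def)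
  \<comment> \<open>The gradient formula requires a nonzero denominator. Continuity provides this
    near 0, and a derivative at 0 sees only values near 0.\<close>
  then have "eventually (\<lambda>s. ?q s \<noteq> 0) (at 0)"
    using q by (rule tendsto_imp_eventually_ne)
  then have "eventually (\<lambda>s. ?q s \<noteq> 0) (nhds 0)"
    using q by (simp add: eventually_nhds_conv_at)
  then have "eventually (\<lambda>s. grad_g (?p s) j = grad_num (?p s) j / (?q s)\<^sup>2) (nhds 0)"
    by eventually_elim (rule grad_g_eq[OF _ j])
  then have "deriv (\<lambda>s. grad_g (?p s) j) 0 = deriv (\<lambda>s. grad_num (?p s) j / (?q s)\<^sup>2) 0"
    by (intro deriv_cong_ev) auto
  also have "\<dots> = (grad_num_deriv v w j * (v 2 - v 0 * v 1)
      - 2 * grad_num v j * (w 2 - w 0 * v 1 - v 0 * w 1)) / (v 2 - v 0 * v 1) ^ 3"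
  proof (rule DERIV_imp_deriv)
    have N: "((\<lambda>s. grad_num (?p s) j) has_field_derivative grad_num_deriv v w j) (at 0)"
      unfolding grad_num_def grad_num_deriv_def
      by (cases "j = 0"; cases "j = 1"; cases "j = 2"; simp)
        ((rule derivative_eq_intros refl)+, simp add: algebra_simps power2_eq_square)+
    have Q: "(?q has_field_derivative w 2 - w 0 * v 1 - v 0 * w 1) (at 0)"
      by (rule derivative_eq_intros refl)+ (simp add: algebra_simps)
    show "((\<lambda>s. grad_num (?p s) j / (?q s)\<^sup>2) has_field_derivative
       (grad_num_deriv v w j * (v 2 - v 0 * v 1)
      - 2 * grad_num v j * (w 2 - w 0 * v 1 - v 0 * w 1)) / (v 2 - v 0 * v 1) ^ 3) (at 0)"
      using DERIV_divide_square[OF N Q] q by simp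
  qed
  finally show ?thesis unfolding hess_g_def grad_g_def w_def .
qed

text \<open>Since \<open>g_nu\<close> is a quotient of polynomials, its linearisation error can be
  written out exactly. It is a sum of two fractions with quadratically small numerators and
  denominators bounded away from 0, so an elementary estimate suffices.\<close>

lemma g_nu_taylor:
  assumes q: "v 2 - v 0 * v 1 \<noteq> 0"
  obtains \<delta> K where "\<delta> > 0" "K > 0"
    "\<And>z. (\<Sum>j<4. (z j - v j)\<^sup>2) < \<delta> \<Longrightarrow>
      \<bar>g_nu z - g_nu v - (\<Sum>j<4. grad_g v j * (z j - v j))\<bar> \<le> K * (\<Sum>j<4. (z j - v j)\<^sup>2)"
proof -
  define \<eta> where "\<eta> = v 2 - v 0 * v 1"
  define \<gamma> where "\<gamma> = g_nu v"
  \<comment> \<open>With \<open>s\<close> the distance from \<open>v\<close>, \<open>B * s\<close>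
    bounds the change of the denominator and \<open>C * s\<close> the linear part \<open>L\<close>
    below. The choice of \<open>\<delta>\<close> ensures \<open>s \<le> 1\<close> and keeps the
    denominator at least \<open>\<bar>\<eta>\<bar> / 2\<close> in modulus; \<open>K\<close> collects
    the bounds of the two error fractions.\<close>
  define B where "B = 2 + \<bar>v 0\<bar> + \<bar>v 1\<bar>"
  define C where "C = \<bar>v 3 - v 2\<bar> + 2 * \<bar>v 0\<bar> + \<bar>\<gamma>\<bar> * B"
  define K where "K = (2 + \<bar>\<gamma>\<bar>) * (2 / \<bar>\<eta>\<bar>) + C * B * (2 / \<eta>\<^sup>2)"
  define \<delta> where "\<delta> = (min 1 (\<bar>\<eta>\<bar> / (2 * B)))\<^sup>2"
  have \<eta>: "\<eta> \<noteq> 0" using q by (simp add: \<eta>_def)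
  have B: "B > 0" by (simp add: B_def add_pos_nonneg)
  have C: "C \<ge> 0" using B by (simp add: C_def)
  have \<gamma>: "\<gamma> * \<eta> = v 0 * (v 3 - v 2)" using q by (simp add: \<gamma>_def \<eta>_def g_nu_def)
  show ?thesis
  proof
    have "min 1 (\<bar>\<eta>\<bar> / (2 * B)) > 0" using \<eta> B by simp
    then show "\<delta> > 0" unfolding \<delta>_def by (rule zero_less_power)
    have "(2 + \<bar>\<gamma>\<bar>) * (2 / \<bar>\<eta>\<bar>) > 0" using \<eta> by (intro mult_pos_pos) auto
    then show "K > 0" using B C by (simp add: K_def add_pos_nonneg)
    fix z :: "nat \<Rightarrow> real"
    define x where "x j = z j - v j" for j
    define s where "s = sqrt (\<Sum>j<4. (x j)\<^sup>2)"
    assume "(\<Sum>j<4. (z j - v j)\<^sup>2) < \<delta>"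
    then have "s < sqrt \<delta>" unfolding s_def x_def by (rule real_sqrt_less_mono)
    moreover have "sqrt \<delta> = min 1 (\<bar>\<eta>\<bar> / (2 * B))" using B by (simp add: \<delta>_def)
    ultimately have s1: "s \<le> 1" and sB: "s * (2 * B) \<le> \<bar>\<eta>\<bar>"
      using B by (auto simp: field_simps)
    have s0: "s \<ge> 0" and s2: "s\<^sup>2 = (\<Sum>j<4. (x j)\<^sup>2)" by (auto simp: s_def sum_nonneg)
    have xs: "\<bar>x j\<bar> \<le> s" if "j < 4" for j
    proof (rule power2_le_imp_le)
      show "\<bar>x j\<bar>\<^sup>2 \<le> s\<^sup>2" unfolding s2 power2_abs using that by (intro member_le_sum) auto
    qed (rule s0)
    have xs4: "\<bar>x 0\<bar> \<le> s" "\<bar>x 1\<bar> \<le> s" "\<bar>x 2\<bar> \<le> s" "\<bar>x 3\<bar> \<le> s"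
      by (auto intro: xs)
    have prod: "\<bar>k * y\<bar> \<le> \<bar>k\<bar> * s" if "\<bar>y\<bar> \<le> s" for k y :: real
      using that by (simp add: abs_mult mult_left_mono)
    have xx: "\<bar>x i * x j\<bar> \<le> s\<^sup>2" if "i < 4" "j < 4" for i j
      using mult_mono[OF xs[OF that(1)] xs[OF that(2)] s0] by (simp add: abs_mult power2_eq_square)
    have ss: "s\<^sup>2 \<le> s" using s0 s1 by (simp add: power2_eq_square mult_left_le)
    define qz where "qz = z 2 - z 0 * z 1"
    define l where "l = x 2 - v 0 * x 1 - v 1 * x 0"
    have z: "z j = v j + x j" for j by (simp add: x_def)
    have l: "\<bar>l\<bar> \<le> s + \<bar>v 0\<bar> * s + \<bar>v 1\<bar> * s"
      unfolding l_def using xs4 prod[of "x 1" "v 0"] prod[of "x 0" "v 1"] by linarith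
    have "qz - \<eta> = l - x 0 * x 1" by (simp add: qz_def \<eta>_def l_def z algebra_simps)
    then have "\<bar>qz - \<eta>\<bar> \<le> s + \<bar>v 0\<bar> * s + \<bar>v 1\<bar> * s + s"
      using l xx[of 0 1] ss by linarith
    then have qd: "\<bar>qz - \<eta>\<bar> \<le> B * s" by (simp add: B_def algebra_simps)
    have qz: "\<bar>qz\<bar> \<ge> \<bar>\<eta>\<bar> / 2" using qd sB by (simp add: algebra_simps)
    then have qz0: "qz \<noteq> 0" using \<eta> by auto
    \<comment> \<open>\<open>L\<close> and \<open>R\<close> are the first- and second-order parts of
      numerator minus \<open>\<gamma>\<close> times denominator at \<open>z\<close>, an expression
      that vanishes at \<open>v\<close>. Dividing \<open>L\<close> by \<open>\<eta>\<close> gives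
      exactly the gradient term.\<close>
    define L where "L = x 0 * (v 3 - v 2) + v 0 * (x 3 - x 2) - \<gamma> * l"
    define R where "R = x 0 * (x 3 - x 2) + \<gamma> * (x 0 * x 1)"
    have Lb: "\<bar>L\<bar> \<le> C * s"
    proof -
      have "\<bar>\<gamma> * l\<bar> \<le> \<bar>\<gamma>\<bar> * (B * s)"
        unfolding abs_mult using l s0 by (intro mult_left_mono) (auto simp: B_def algebra_simps)
      moreover have "\<bar>x 0 * (v 3 - v 2)\<bar> \<le> \<bar>v 3 - v 2\<bar> * s"
        using prod[of "x 0" "v 3 - v 2"] xs4 by (simp add: mult.commute)
      moreover have "\<bar>v 0 * (x 3 - x 2)\<bar> \<le> 2 * \<bar>v 0\<bar> * s"
        using prod[of "x 3" "v 0"] prod[of "x 2" "v 0"] xs4 by (simp add: algebra_simps) linarith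
      ultimately show ?thesis unfolding L_def C_def by (simp add: algebra_simps) linarith
    qed
    have Rb: "\<bar>R\<bar> \<le> (2 + \<bar>\<gamma>\<bar>) * s\<^sup>2"
    proof -
      have "\<bar>\<gamma> * (x 0 * x 1)\<bar> \<le> \<bar>\<gamma>\<bar> * s\<^sup>2"
        unfolding abs_mult[of \<gamma>] using xx[of 0 1] by (intro mult_left_mono) auto
      then show ?thesis unfolding R_def using xx[of 0 3] xx[of 0 2] by (simp add: algebra_simps)
    qed
    have "z 0 * (z 3 - z 2) - \<gamma> * qz = L + R + (v 0 * (v 3 - v 2) - \<gamma> * \<eta>)"
      by (simp add: L_def R_def l_def qz_def \<eta>_def z algebra_simps)
    then have num: "z 0 * (z 3 - z 2) = L + R + \<gamma> * qz" using \<gamma> by simp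
    have grad: "(\<Sum>j<4. grad_g v j * (z j - v j)) = L / \<eta>"
    proof -
      have "(\<Sum>j<4. grad_g v j * x j) = (\<Sum>j<4. grad_num v j * x j) / \<eta>\<^sup>2"
        unfolding sum_divide_distrib \<eta>_def by (intro sum.cong) (auto simp: grad_g_eq[of v, OF q] simp del: One_nat_def)
      also have "(\<Sum>j<4. grad_num v j * x j) = x 0 * (v 3 - v 2) * \<eta> + v 0 * (x 3 - x 2) * \<eta> - (\<gamma> * \<eta>) * l"
        unfolding \<gamma> by (simp add: grad_num_def eval_nat_numeral \<eta>_def l_def)
          (simp add: algebra_simps)
      also have "\<dots> = L * \<eta>" by (simp add: L_def algebra_simps)
      finally show ?thesis using \<eta> by (simp add: x_def power2_eq_square)
    qed
    \<comment> \<open>The increment of \<open>g_nu\<close> is \<open>(L + R) / qz\<close>; replacing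
      \<open>qz\<close> by \<open>\<eta>\<close> under \<open>L\<close> costs the second fraction, a
      product of two first-order terms.\<close>
    have "g_nu z - g_nu v - L / \<eta> = R / qz + L * (\<eta> - qz) / (qz * \<eta>)"
      using qz0 \<eta> num unfolding g_nu_def[of z] qz_def[symmetric] \<gamma>_def[symmetric]
      by (simp add: field_simps)
    also have "\<bar>\<dots>\<bar> \<le> (2 + \<bar>\<gamma>\<bar>) * s\<^sup>2 * (2 / \<bar>\<eta>\<bar>) + (C * s) * (B * s) * (2 / \<eta>\<^sup>2)"
    proof -
      have i: "1 / \<bar>qz\<bar> \<le> 2 / \<bar>\<eta>\<bar>" using qz \<eta> qz0 by (simp add: field_simps)
      have "\<bar>R / qz\<bar> = \<bar>R\<bar> * (1 / \<bar>qz\<bar>)" by simp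
      also have "\<dots> \<le> (2 + \<bar>\<gamma>\<bar>) * s\<^sup>2 * (2 / \<bar>\<eta>\<bar>)" using Rb i by (intro mult_mono) auto
      finally have 1: "\<bar>R / qz\<bar> \<le> (2 + \<bar>\<gamma>\<bar>) * s\<^sup>2 * (2 / \<bar>\<eta>\<bar>)" .
      have "\<bar>L * (\<eta> - qz) / (qz * \<eta>)\<bar> = \<bar>L\<bar> * \<bar>qz - \<eta>\<bar> * (1 / \<bar>qz\<bar> * (1 / \<bar>\<eta>\<bar>))"
        by (simp add: abs_mult abs_minus_commute)
      also have "\<dots> \<le> (C * s) * (B * s) * (2 / \<bar>\<eta>\<bar> * (1 / \<bar>\<eta>\<bar>))"
        using Lb qd i C B s0 by (intro mult_mono) auto
      also have "2 / \<bar>\<eta>\<bar> * (1 / \<bar>\<eta>\<bar>) = 2 / \<eta>\<^sup>2" by (simp add: power2_eq_square)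
      finally show ?thesis using 1 by linarith
    qed
    also have "\<dots> = K * s\<^sup>2" by (simp add: K_def algebra_simps power2_eq_square add_divide_distrib)
    finally show "\<bar>g_nu z - g_nu v - (\<Sum>j<4. grad_g v j * (z j - v j))\<bar> \<le> K * (\<Sum>j<4. (z j - v j)\<^sup>2)"
      unfolding grad s2 x_def .
  qed
qed

subsection \<open>Moments of the negative binomial distribution\<close>

text \<open>The absorption identity for binomial coefficients, together with
  \<open>1 - \<pi> = \<mu> / (\<nu> + \<mu>)\<close>. This recurrence is the source of positivity,
  of the finiteness of power moments and of Stein's identity.\<close>

lemma nb_mu_Suc:
  assumes "\<mu> > 0" "\<nu> > 0"
  shows "nb_mu \<nu> \<mu> (Suc x) * real (Suc x) = \<mu> / (\<nu> + \<mu>) * ((\<nu> + real x) * nb_mu \<nu> \<mu> x)"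
proof -
  have "real (Suc x) * ((\<nu> + real x) gchoose Suc x) = (\<nu> + real x) * ((\<nu> + real x - 1) gchoose x)"
    using gbinomial_factors[of "\<nu> + real x - 1" x] by (simp add: field_simps)
  moreover have "1 - \<nu> / (\<nu> + \<mu>) = \<mu> / (\<nu> + \<mu>)" using assms by (simp add: field_simps)
  moreover have "\<nu> + real (Suc x) - 1 = \<nu> + real x" by simp
  ultimately show ?thesis unfolding nb_mu_def nb_pmf_def
    by (simp only:) (simp del: of_nat_Suc add: mult_ac)
qed

lemma nb_mu_pos:
  assumes "\<mu> > 0" "\<nu> > 0"
  shows "nb_mu \<nu> \<mu> x > 0"
proof (induction x)
  case 0
  then show ?case using assms by (simp add: nb_mu_def nb_pmf_def)
next
  case (Suc x)
  have "nb_mu \<nu> \<mu> (Suc x) * real (Suc x) > 0"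
    unfolding nb_mu_Suc[OF assms] using Suc assms by (intro mult_pos_pos divide_pos_pos) auto
  then show ?case by (simp add: zero_less_mult_iff)
qed

text \<open>By the recurrence, the ratio of consecutive terms tends to
  \<open>\<mu> / (\<nu> + \<mu>) < 1\<close>, hence eventually stays below the midpoint between this
  limit and 1.\<close>

lemma summable_nb_mu_power:
  assumes "\<mu> > 0" "\<nu> > 0"
  shows "summable (\<lambda>x. nb_mu \<nu> \<mu> x * real x ^ k)"
proof -
  let ?p = "nb_mu \<nu> \<mu>"
  define r where "r = \<mu> / (\<nu> + \<mu>)"
  have r: "r < 1" using assms by (simp add: r_def)
  have "(\<lambda>x. r * ((\<nu> + real x) / (1 + real x)) * (1 + 1 / real x) ^ k) \<longlonglongrightarrow> r * 1 * (1 + 0) ^ k"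
    by (intro tendsto_intros; real_asymp)
  then have "(\<lambda>x. r * ((\<nu> + real x) / (1 + real x)) * (1 + 1 / real x) ^ k) \<longlonglongrightarrow> r" by simp
  then have "\<forall>\<^sub>F x in sequentially. r * ((\<nu> + real x) / (1 + real x)) * (1 + 1 / real x) ^ k < (1 + r) / 2"
    using r by (intro order_tendstoD(2)) auto
  then obtain n0 where n0: "\<And>x. x \<ge> n0 \<Longrightarrow>
      r * ((\<nu> + real x) / (1 + real x)) * (1 + 1 / real x) ^ k < (1 + r) / 2"
    by (auto simp: eventually_sequentially)
  show ?thesis
  proof (rule summable_ratio_test)
    show "(1 + r) / 2 < 1" using r by simp
    \<comment> \<open>The lower bound 1 makes the division by \<open>real x\<close> in the ratio
      legitimate.\<close>
    fix x assume x: "max 1 n0 \<le> x"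
    have p: "?p x > 0" "?p (Suc x) > 0" using nb_mu_pos[OF assms] by auto
    have "?p (Suc x) = r * ((\<nu> + real x) / (1 + real x)) * ?p x"
    proof -
      have "?p (Suc x) = ?p (Suc x) * real (Suc x) / (1 + real x)" by (simp add: field_simps)
      also have "\<dots> = r * ((\<nu> + real x) / (1 + real x)) * ?p x"
        unfolding nb_mu_Suc[OF assms] by (simp add: r_def)
      finally show ?thesis .
    qed
    moreover have "real (Suc x) ^ k = (1 + 1 / real x) ^ k * real x ^ k"
      using x by (simp add: field_simps flip: power_mult_distrib)
    ultimately have "?p (Suc x) * real (Suc x) ^ k
        = (r * ((\<nu> + real x) / (1 + real x)) * (1 + 1 / real x) ^ k) * (?p x * real x ^ k)"
      by simp
    also have "\<dots> \<le> (1 + r) / 2 * (?p x * real x ^ k)"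
      using n0[of x] x p by (intro mult_right_mono) auto
    finally show "norm (?p (Suc x) * real (Suc x) ^ k) \<le> (1 + r) / 2 * norm (?p x * real x ^ k)"
      using p by simp
  qed
qed

text \<open>The factor \<open>real x\<close> kills the term at 0; shifting the index and applying
  the recurrence to the remaining terms gives the right-hand side.\<close>

lemma nb_E_stein:
  assumes "\<mu> > 0" "\<nu> > 0" and s: "summable (\<lambda>x. nb_mu \<nu> \<mu> x * (real x * h x))"
  shows "nb_E \<nu> \<mu> (\<lambda>x. real x * h x) = \<mu> / (\<nu> + \<mu>) * nb_E \<nu> \<mu> (\<lambda>x. (\<nu> + real x) * h (Suc x))"
proof -
  let ?F = "\<lambda>x. nb_mu \<nu> \<mu> x * (real x * h x)"
  have eq: "?F (Suc x) = \<mu> / (\<nu> + \<mu>) * (nb_mu \<nu> \<mu> x * ((\<nu> + real x) * h (Suc x)))" for x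
    using arg_cong[OF nb_mu_Suc[OF assms(1,2), of x], of "\<lambda>y. y * h (Suc x)"]
    by (simp only: mult_ac)
  have sS: "summable (\<lambda>x. ?F (Suc x))" using s by (subst summable_Suc_iff)
  \<comment> \<open>A nonzero factor lets summability pass from the shifted series to the series
    without that factor.\<close>
  have ne: "\<mu> / (\<nu> + \<mu>) \<noteq> 0" using assms by auto
  have "(\<Sum>x. ?F x) = (\<Sum>x. ?F (Suc x))" using suminf_split_head[OF s] by simp
  also have "\<dots> = \<mu> / (\<nu> + \<mu>) * (\<Sum>x. nb_mu \<nu> \<mu> x * ((\<nu> + real x) * h (Suc x)))"
    using sS unfolding eq by (intro suminf_mult) (use ne summable_cmult_iff in blast)
  finally show ?thesis by (simp add: nb_E_def)
qed

lemma nb_E_cmult: "summable (\<lambda>x. nb_mu \<nu> \<mu> x * h x) \<Longrightarrow> nb_E \<nu> \<mu> (\<lambda>x. c * h x) = c * nb_E \<nu> \<mu> h"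
  unfolding nb_E_def by (subst suminf_mult[symmetric]) (auto simp: mult_ac)

lemma nb_E_add:
  "summable (\<lambda>x. nb_mu \<nu> \<mu> x * h x) \<Longrightarrow> summable (\<lambda>x. nb_mu \<nu> \<mu> x * k x) \<Longrightarrow>
    nb_E \<nu> \<mu> (\<lambda>x. h x + k x) = nb_E \<nu> \<mu> h + nb_E \<nu> \<mu> k"
  unfolding nb_E_def by (simp add: suminf_add distrib_left)

lemma summable_nb_cmult: "summable (\<lambda>x. nb_mu \<nu> \<mu> x * h x) \<Longrightarrow> summable (\<lambda>x. nb_mu \<nu> \<mu> x * (c * h x))"
  by (drule summable_mult[of _ c]) (simp add: mult_ac)

lemma nb_E_const:
  assumes "\<mu> > 0" "\<nu> > 0" and "nb_E \<nu> \<mu> (\<lambda>_. 1) = 1"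
  shows "nb_E \<nu> \<mu> (\<lambda>_. c) = c"
  using nb_E_cmult[of \<nu> \<mu> "\<lambda>_. 1" c] summable_nb_mu_power[OF assms(1,2), of 0] assms(3) by simp

text \<open>Stein's identity with \<open>h = 1\<close> is a linear equation for the mean. Total mass
  one enters as a hypothesis, to be supplied by random variables that have this law.\<close>

lemma nb_E_mean:
  assumes pos: "\<mu> > 0" "\<nu> > 0" and one: "nb_E \<nu> \<mu> (\<lambda>_. 1) = 1"
  shows "nb_E \<nu> \<mu> real = \<mu>"
proof -
  note s = summable_nb_mu_power[OF pos]
  have "nb_E \<nu> \<mu> real = \<mu> / (\<nu> + \<mu>) * nb_E \<nu> \<mu> (\<lambda>x. \<nu> * 1 + real x)"
    using nb_E_stein[OF pos, of "\<lambda>_. 1"] s[of 1] by simp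
  also have "nb_E \<nu> \<mu> (\<lambda>x. \<nu> * 1 + real x) = \<nu> + nb_E \<nu> \<mu> real"
    using s[of 0] s[of 1] summable_nb_cmult[of \<nu> \<mu> "\<lambda>_. 1" \<nu>]
    by (subst nb_E_add) (auto simp: nb_E_const[OF assms])
  finally show ?thesis using pos by (simp add: field_simps)
qed

text \<open>Stein's identity with \<open>h = real\<close> and
  \<open>(\<nu> + x) * (x + 1) = \<nu> + (\<nu> + 1) * x + x\<^sup>2\<close> gives a linear equation
  for the second moment.\<close>

lemma nb_E_square:
  assumes pos: "\<mu> > 0" "\<nu> > 0" and one: "nb_E \<nu> \<mu> (\<lambda>_. 1) = 1"
  shows "nb_E \<nu> \<mu> (\<lambda>x. (real x)\<^sup>2) = (\<nu> + \<mu>) / \<nu> * \<mu> + \<mu>\<^sup>2"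
proof -
  note s = summable_nb_mu_power[OF pos]
  have s01: "summable (\<lambda>x. nb_mu \<nu> \<mu> x * (\<nu> * 1))" "summable (\<lambda>x. nb_mu \<nu> \<mu> x * ((\<nu> + 1) * real x))"
    using summable_nb_cmult[of \<nu> \<mu> "\<lambda>_. 1" \<nu>] summable_nb_cmult[of \<nu> \<mu> real "\<nu> + 1"] s[of 0] s[of 1] by auto
  have "nb_E \<nu> \<mu> (\<lambda>x. (real x)\<^sup>2) = \<mu> / (\<nu> + \<mu>) * nb_E \<nu> \<mu> (\<lambda>x. (\<nu> * 1 + (\<nu> + 1) * real x) + (real x)\<^sup>2)"
    using nb_E_stein[OF pos, of real] s[of 2] by (simp add: power2_eq_square algebra_simps)
  also have "nb_E \<nu> \<mu> (\<lambda>x. (\<nu> * 1 + (\<nu> + 1) * real x) + (real x)\<^sup>2)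
     = nb_E \<nu> \<mu> (\<lambda>x. \<nu> * 1) + nb_E \<nu> \<mu> (\<lambda>x. (\<nu> + 1) * real x) + nb_E \<nu> \<mu> (\<lambda>x. (real x)\<^sup>2)"
    using s01 s[of 2] summable_add[OF s01] by (subst nb_E_add, simp add: distrib_left, simp)
      (subst nb_E_add, auto)
  also have "\<dots> = \<nu> + (\<nu> + 1) * \<mu> + nb_E \<nu> \<mu> (\<lambda>x. (real x)\<^sup>2)"
    using s[of 1] by (simp add: nb_E_cmult nb_E_const[OF assms] nb_E_mean[OF assms])
  finally show ?thesis using pos by (simp add: field_simps power2_eq_square)
qed

subsection \<open>The asymptotic law\<close>

text \<open>Each coordinate of \<open>Z\<close> is a monomial in \<open>X\<close>,
  \<open>f(X)\<close> and \<open>f(X+1)\<close>. Recording exponents turns products of coordinates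
  into sums of triples, so every covariance entry is read off in terms of \<open>mt\<close>.\<close>

definition Zc_exponents :: "nat \<Rightarrow> nat \<times> nat \<times> nat" where
  "Zc_exponents j = (if j = 0 then (1, 0, 0) else if j = 1 then (0, 0, 1) else if j = 2 then (1, 1, 0) else (1, 0, 1))"

lemma Zc_eq_mom_fun: "Zc f j = (case Zc_exponents j of (k, l, m) \<Rightarrow> mom_fun f k l m)"
  by (auto simp: Zc_def Zc_exponents_def mom_fun_def fun_eq_iff)

lemma Zc_mult_eq_mom_fun:
  "Zc f i x * Zc f j x = (case (Zc_exponents i, Zc_exponents j) of
    ((k, l, m), (k', l', m')) \<Rightarrow> mom_fun f (k + k') (l + l') (m + m') x)"
  by (simp add: Zc_eq_mom_fun mom_fun_def power_add split: prod.split)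

lemma muZ_eq_mt: "muZ f \<nu> \<mu> j = (case Zc_exponents j of (k, l, m) \<Rightarrow> mt f \<nu> \<mu> k l m)"
  by (simp add: muZ_def Zc_eq_mom_fun mt_def split: prod.split)

lemma SigmaZ_eq_mt: "SigmaZ f \<nu> \<mu> i j = (case (Zc_exponents i, Zc_exponents j) of
    ((k, l, m), (k', l', m')) \<Rightarrow> mt f \<nu> \<mu> (k + k') (l + l') (m + m') - mt f \<nu> \<mu> k l m * mt f \<nu> \<mu> k' l' m')"
  by (simp add: SigmaZ_def muZ_eq_mt Zc_mult_eq_mom_fun mt_def split: prod.split)

theorem theorem6:
  fixes M :: "'a measure" and X :: "nat \<Rightarrow> 'a \<Rightarrow> nat"
    and f :: "nat \<Rightarrow> real" and \<nu> \<mu> :: real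
  defines "t \<equiv> mt f \<nu> \<mu>"
  defines "s2 \<equiv> (\<nu> + \<mu>) / \<nu> * \<mu>"
  defines "\<eta> \<equiv> t 1 1 0 - \<mu> * t 0 0 1"
  assumes "prob_space M"
    and pos: "\<mu> > 0" "\<nu> > 0"
    and meas: "\<And>i. X i \<in> measurable M (count_space UNIV)"
    and indep: "prob_space.indep_vars M (\<lambda>_. count_space UNIV) X UNIV"
    and law: "\<And>i x. measure M {\<omega> \<in> space M. X i \<omega> = x} = nb_mu \<nu> \<mu> x"
    and fin: "\<And>k l m. (k, l, m) \<in> {(0,0,1), (0,0,2), (1,0,1), (1,0,2), (1,1,0), (1,1,1),
                              (2,0,1), (2,0,2), (2,1,0), (2,1,1), (2,2,0)}
                \<Longrightarrow> mt_finite f \<nu> \<mu> k l m"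
    and eta: "\<eta> \<noteq> 0"
  shows "weak_conv_m (\<lambda>n. distr M borel (\<lambda>\<omega>. sqrt (real n) * (nu_hat f X n \<omega> - \<nu>)))
                     (normal_law (quad_DSD f \<nu> \<mu>))
    \<and> (\<forall>n>0. asym_var f \<nu> \<mu> n = 1 / (\<eta> ^ 4 * real n) * (
          \<mu>^4 * (t 0 0 1 * (t 0 0 1 * (t 2 0 2 - 2 * t 2 1 1 + t 2 2 0)
                  - 2 * (t 1 0 1 - t 1 1 0) * (t 1 0 2 - t 1 1 1))
                + t 0 0 2 * (t 1 0 1 - t 1 1 0)^2)
        + 2 * \<mu>^3 * (t 0 0 1 * t 1 0 1 * (t 2 1 1 - t 2 2 0)
                  - t 1 1 0 * (t 0 0 1 * (t 2 0 2 - t 2 1 1) + t 1 0 2 * t 1 1 0)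
                  - t 1 0 1^2 * t 1 1 1 + t 1 0 1 * t 1 1 0 * (t 1 0 2 + t 1 1 1))
        + \<mu>^2 * (t 1 1 0 * (2 * t 1 0 1 * (- t 0 0 1 * t 2 0 1 + t 0 0 1 * t 2 1 0 + t 1 1 0^2 - t 2 1 1)
                             + t 1 1 0 * (2 * t 0 0 1 * t 2 0 1 - 2 * t 0 0 1 * t 2 1 0 + t 2 0 2)
                             + 2 * t 1 0 1^3 - 4 * t 1 0 1^2 * t 1 1 0)
                  + t 1 0 1^2 * t 2 2 0)
        - 2 * \<mu> * t 1 1 0 * (t 1 0 1 - t 1 1 0) * (t 1 0 1 * t 2 1 0 - t 1 1 0 * t 2 0 1)
        + t 1 1 0^2 * s2 * (t 1 0 1 - t 1 1 0)^2))
    \<and> (\<forall>n>0. asym_bias f \<nu> \<mu> n = - (1 / (\<eta> ^ 3 * real n)) * (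
          \<mu>^3 * (t 0 0 1 * (t 1 0 2 - t 1 1 1) + t 0 0 2 * (t 1 1 0 - t 1 0 1))
        - \<mu>^2 * (t 0 0 1 * (t 2 1 1 - t 2 2 0) - 2 * t 1 0 1 * t 1 1 1 + t 1 1 0 * (t 1 0 2 + t 1 1 1))
        + \<mu> * (t 1 0 1 * (t 0 0 1 * t 2 1 0 + 2 * t 1 1 0^2 - t 2 2 0)
               + t 1 1 0 * (t 0 0 1 * t 2 0 1 - 2 * t 0 0 1 * t 2 1 0 + t 2 1 1)
               - 2 * t 1 0 1^2 * t 1 1 0)
        + t 1 1 0 * (t 0 0 1 * s2 * (t 1 1 0 - t 1 0 1) + t 1 0 1 * t 2 1 0 - t 1 1 0 * t 2 0 1)))"
proof -
  interpret prob_space M by fact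

  \<comment> \<open>The common law of the observations and integrability\<close>
  let ?N = "count_space (UNIV :: nat set)"
  define p where "p = nb_mu \<nu> \<mu>"
  have p0: "p x \<ge> 0" for x using nb_mu_pos[OF pos, of x] by (simp add: p_def less_imp_le)
  define P where "P = density ?N (\<lambda>x. ennreal (p x))"
  note [measurable] = meas
  have ident: "distr M ?N (X i) = P" for i
  proof (rule measure_eqI_countable[where A = UNIV])
    fix x
    have "X i -` {x} \<inter> space M = {\<omega> \<in> space M. X i \<omega> = x}" by auto
    then show "emeasure (distr M ?N (X i)) {x} = emeasure P {x}"
      using law[of i x] by (simp add: emeasure_distr P_def emeasure_density p_def
          emeasure_eq_measure nn_integral_indicator_singleton)
  qed (auto simp: P_def)
  have Pint: "integrable P h \<longleftrightarrow> summable (\<lambda>x. \<bar>p x * h x\<bar>)" for h :: "nat \<Rightarrow> real"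
    unfolding P_def using p0 by (subst integrable_real_density) (auto simp: integrable_count_space_nat_iff)
  have PE: "(\<integral>x. h x \<partial>P) = nb_E \<nu> \<mu> h" if "integrable P h" for h :: "nat \<Rightarrow> real"
    using that p0 unfolding P_def nb_E_def p_def[symmetric]
    by (simp add: integral_real_density integrable_real_density integral_count_space_nat)
  interpret P: prob_space P unfolding ident[of 0, symmetric] by (rule prob_space_distr) simp
  \<comment> \<open>The law of an observation is a probability measure, which yields the
    normalisation of the mass function without summing the binomial series.\<close>
  have one: "nb_E \<nu> \<mu> (\<lambda>_. 1) = 1" using PE[of "\<lambda>_. 1"] by (simp add: P.prob_space)
  \<comment> \<open>The triples \<open>(1,0,0)\<close> and \<open>(2,0,0)\<close> are pure power
    moments, finite for every law of this family; the others are the assumed ones.\<close>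
  have fin': "mt_finite f \<nu> \<mu> k l m" if "(k, l, m) \<in> {(0,0,1), (0,0,2), (1,0,0), (1,0,1), (1,0,2),
      (1,1,0), (1,1,1), (2,0,0), (2,0,1), (2,0,2), (2,1,0), (2,1,1), (2,2,0)}" for k l m
  proof (cases "l = 0 \<and> m = 0")
    case True
    then show ?thesis
      using summable_nb_mu_power[OF pos, of k] nb_mu_pos[OF pos]
      by (simp add: mt_finite_def mom_fun_def abs_mult less_imp_le)
  next
    case False
    then show ?thesis using that by (intro fin) auto
  qed
  have intZ: "integrable P (Zc f j)" if "j < 4" for j
    unfolding Pint Zc_eq_mom_fun p_def using less_4_cases[OF that] fin'
    by (elim disjE) (simp_all add: Zc_exponents_def mt_finite_def)
  have intZZ: "integrable P (\<lambda>x. Zc f i x * Zc f j x)" if "i < 4" "j < 4" for i j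
    unfolding Pint Zc_mult_eq_mom_fun p_def using less_4_cases[OF that(1)] less_4_cases[OF that(2)] fin'
    by (elim disjE) (simp_all add: Zc_exponents_def mt_finite_def eval_nat_numeral)

  \<comment> \<open>Moment identities of the negative binomial law\<close>
  have t100: "t 1 0 0 = \<mu>"
    using nb_E_mean[OF pos one] by (simp add: t_def mt_def mom_fun_def[abs_def])
  have t200: "t 2 0 0 = s2 + \<mu>\<^sup>2"
    using nb_E_square[OF pos one] by (simp add: t_def mt_def mom_fun_def[abs_def] s2_def)
  \<comment> \<open>Stein's identity with \<open>h = f\<close> reads \<open>(\<nu> + \<mu>) * t 1 1
    0 = \<mu> * (\<nu> * t 0 0 1 + t 1 0 1)\<close>. Rearranged, it says that the numerator of
    \<open>g_nu\<close> at the mean vector is \<open>\<nu>\<close> times its denominator.\<close>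
  have stein: "\<mu> * (t 1 0 1 - t 1 1 0) = \<nu> * \<eta>"
  proof -
    have s: "summable (\<lambda>x. p x * mom_fun f k l m x)" if "mt_finite f \<nu> \<mu> k l m" for k l m
      using that unfolding mt_finite_def p_def by (rule summable_rabs_cancel)
    note s110 = s[OF fin', of 1 1 0] and s001 = s[OF fin', of 0 0 1] and s101 = s[OF fin', of 1 0 1]
    have "t 1 1 0 = \<mu> / (\<nu> + \<mu>) * nb_E \<nu> \<mu> (\<lambda>x. \<nu> * f (Suc x) + real x * f (Suc x))"
      using nb_E_stein[OF pos, of f] s110 by (simp add: t_def mt_def mom_fun_def[abs_def] p_def algebra_simps)
    also have "nb_E \<nu> \<mu> (\<lambda>x. \<nu> * f (Suc x) + real x * f (Suc x)) = \<nu> * t 0 0 1 + t 1 0 1"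
      using s001 s101 summable_nb_cmult[of \<nu> \<mu> "\<lambda>x. f (Suc x)" \<nu>]
      by (subst nb_E_add) (auto simp: t_def mt_def mom_fun_def[abs_def] p_def nb_E_cmult)
    finally show ?thesis using pos by (simp add: \<eta>_def field_simps)
  qed

  \<comment> \<open>Mean vector and covariance matrix of \<open>Z\<close>\<close>
  let ?v = "muZ f \<nu> \<mu>"
  have v: "?v 0 = \<mu>" "?v 1 = t 0 0 1" "?v 2 = t 1 1 0" "?v 3 = t 1 0 1"
    using t100 by (simp_all add: muZ_eq_mt Zc_exponents_def t_def)
  have q: "?v 2 - ?v 0 * ?v 1 = \<eta>" by (simp only: v \<eta>_def)
  have q0: "?v 2 - ?v 0 * ?v 1 \<noteq> 0" using eta by (simp only: q not_False_eq_True)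
  have gv: "g_nu ?v = \<nu>" unfolding g_nu_def q unfolding v stein using eta by simp
  have S: "SigmaZ f \<nu> \<mu> 0 0 = s2" "SigmaZ f \<nu> \<mu> 0 1 = t 1 0 1 - \<mu> * t 0 0 1"
     "SigmaZ f \<nu> \<mu> 0 2 = t 2 1 0 - \<mu> * t 1 1 0" "SigmaZ f \<nu> \<mu> 0 3 = t 2 0 1 - \<mu> * t 1 0 1"
     "SigmaZ f \<nu> \<mu> 1 0 = t 1 0 1 - \<mu> * t 0 0 1" "SigmaZ f \<nu> \<mu> 1 1 = t 0 0 2 - (t 0 0 1)\<^sup>2"
     "SigmaZ f \<nu> \<mu> 1 2 = t 1 1 1 - t 0 0 1 * t 1 1 0" "SigmaZ f \<nu> \<mu> 1 3 = t 1 0 2 - t 0 0 1 * t 1 0 1"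
     "SigmaZ f \<nu> \<mu> 2 0 = t 2 1 0 - \<mu> * t 1 1 0" "SigmaZ f \<nu> \<mu> 2 1 = t 1 1 1 - t 0 0 1 * t 1 1 0"
     "SigmaZ f \<nu> \<mu> 2 2 = t 2 2 0 - (t 1 1 0)\<^sup>2" "SigmaZ f \<nu> \<mu> 2 3 = t 2 1 1 - t 1 1 0 * t 1 0 1"
     "SigmaZ f \<nu> \<mu> 3 0 = t 2 0 1 - \<mu> * t 1 0 1" "SigmaZ f \<nu> \<mu> 3 1 = t 1 0 2 - t 0 0 1 * t 1 0 1"
     "SigmaZ f \<nu> \<mu> 3 2 = t 2 1 1 - t 1 1 0 * t 1 0 1" "SigmaZ f \<nu> \<mu> 3 3 = t 2 0 2 - (t 1 0 1)\<^sup>2"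
    using t100 t200
    by (simp_all add: SigmaZ_eq_mt Zc_exponents_def t_def power2_eq_square eval_nat_numeral mult.commute)
  have sum4: "(\<Sum>j<4. h j) = h 0 + h 1 + h 2 + h 3" for h :: "nat \<Rightarrow> real"
    by (simp add: eval_nat_numeral)
  have N: "grad_num ?v 0 = t 1 1 0 * (t 1 0 1 - t 1 1 0)" "grad_num ?v 1 = \<mu>\<^sup>2 * (t 1 0 1 - t 1 1 0)"
    "grad_num ?v 2 = \<mu> * (\<mu> * t 0 0 1 - t 1 0 1)" "grad_num ?v 3 = \<mu> * \<eta>"
    by (simp_all add: grad_num_def v \<eta>_def del: One_nat_def)

  \<comment> \<open>Asymptotic normality\<close>
  have clt: "weak_conv_m (\<lambda>n. distr M borel (\<lambda>\<omega>. sqrt (real n) * (nu_hat f X n \<omega> - \<nu>)))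
                     (normal_law (quad_DSD f \<nu> \<mu>))"
  proof -
    obtain \<delta> K where T: "\<delta> > 0" "K > 0"
      "\<And>z. (\<Sum>j<4. (z j - ?v j)\<^sup>2) < \<delta> \<Longrightarrow>
        \<bar>g_nu z - g_nu ?v - (\<Sum>j<4. grad_g ?v j * (z j - ?v j))\<bar> \<le> K * (\<Sum>j<4. (z j - ?v j)\<^sup>2)"
      using g_nu_taylor[OF q0] by blast
    \<comment> \<open>Numerators and denominators agree separately, so the identity also covers
      \<open>n = 0\<close> and vanishing denominators.\<close>
    have hat: "g_nu (\<lambda>j. (\<Sum>i<n. Zc f j (X i \<omega>)) / real n) = nu_hat f X n \<omega>" for n \<omega>
      by (simp add: g_nu_def nu_hat_def Zc_def smean_def right_diff_distrib sum_subtractf diff_divide_distrib)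
    have "weak_conv_m (\<lambda>n. distr M borel (\<lambda>\<omega>. sqrt (real n) *
          (g_nu (\<lambda>j. (\<Sum>i<n. Zc f j (X i \<omega>)) / real n) - g_nu ?v)))
       (normal_law (\<Sum>i<4. \<Sum>j<4. grad_g ?v i * ((\<integral>x. Zc f i x * Zc f j x \<partial>P) - ?v i * ?v j) * grad_g ?v j))"
    proof (rule delta_method[OF indep ident _ _ _ _ _ T])
      show "(\<lambda>\<omega>. g_nu (\<lambda>j. (\<Sum>i<n. Zc f j (X i \<omega>)) / real n)) \<in> borel_measurable M" for n
        unfolding g_nu_def by measurable
    qed (auto simp: intZ PE muZ_def intZZ[of j j for j, folded power2_eq_square])
    moreover have "(\<Sum>i<4. \<Sum>j<4. grad_g ?v i * ((\<integral>x. Zc f i x * Zc f j x \<partial>P) - ?v i * ?v j) * grad_g ?v j)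
       = quad_DSD f \<nu> \<mu>"
      unfolding quad_DSD_def SigmaZ_def by (intro sum.cong) (auto simp: PE intZZ)
    ultimately show ?thesis unfolding hat gv by simp
  qed

  \<comment> \<open>Closed forms of variance and bias\<close>
  have var: "quad_DSD f \<nu> \<mu> = (\<Sum>i<4. \<Sum>j<4. grad_num ?v i * SigmaZ f \<nu> \<mu> i j * grad_num ?v j) / \<eta> ^ 4"
    unfolding quad_DSD_def sum_divide_distrib
    by (intro sum.cong refl) (auto simp: grad_g_eq[OF q0, unfolded q] power2_eq_square power4_eq_xxxx)
  have bias: "(\<Sum>i<4. \<Sum>j<4. hess_g ?v i j * SigmaZ f \<nu> \<mu> i j) =
     (\<Sum>i<4. \<Sum>j<4. (grad_num_deriv ?v (unitv i) j * \<eta>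
      - 2 * grad_num ?v j * (unitv i 2 - unitv i 0 * ?v 1 - ?v 0 * unitv i 1)) * SigmaZ f \<nu> \<mu> i j) / \<eta> ^ 3"
    unfolding sum_divide_distrib
    by (intro sum.cong refl) (auto simp: hess_g_eq[OF q0, unfolded q])
  show ?thesis
  proof (intro conjI allI impI clt, goal_cases)
    case (1 n)
    \<comment> \<open>Splitting off the denominator leaves a polynomial identity in
      \<open>\<mu>\<close>, \<open>s2\<close> and the moments once \<open>\<eta>\<close> is
      expanded.\<close>
    have frac: "A / \<eta> ^ 4 / real n = 1 / (\<eta> ^ 4 * real n) * B" if "A = B" for A B
      using that by simp
    show ?case
      unfolding asym_var_def var unfolding sum4 S N
      by (rule frac, simp only: \<eta>_def)
        (simp only: power2_eq_square power3_eq_cube power4_eq_xxxx algebra_simps)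
  next
    case (2 n)
    \<comment> \<open>The factor \<open>- 2\<close> combines the \<open>1 / 2\<close> in the
      definition of the bias with the sign in front of the closed formula.\<close>
    have frac: "A / \<eta> ^ 3 / (2 * real n) = - (1 / (\<eta> ^ 3 * real n)) * B" if "A = - 2 * B" for A B
      using that by simp
    show ?case
      unfolding asym_bias_def bias unfolding sum4 S N
      by (rule frac, simp add: grad_num_deriv_def unitv_def v \<eta>_def del: One_nat_def)
        (simp add: algebra_simps power2_eq_square power3_eq_cube del: One_nat_def)
  qed
qed

end
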